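(* Let $\alpha\neq0$ (and $\alpha\ne1$). The map $p\mapsto p^{(\alpha)}$ establishes a one-to-one correspondence (bijection) between an $\mathscr{E}^{(\alpha)}$-family characterized by $h,f,w,\Theta$ and $\mathbb{S}$, and the $\mathbb{M}^{(1/\alpha)}$-family characterized by the same entities $h,f,w,\Theta$ and $\mathbb{S}$, where $$p^{(\alpha)}(\mathbf{x})=\frac{p(\mathbf{x})^\alpha}{\int p(\mathbf{y})^\alpha\,d\mathbf{y}}$$ is the $\alpha$-scaled (escort) measure associated with $p$.
   Context: Let $\Theta\subset\mathbb{R}^k$ be open, $w=[w_1,\dots,w_s]^\top$ with $w_i:\Theta\to\mathbb{R}$ differentiable, $f=[f_1,\dots,f_s]^\top$ with $f_i:\mathbb{R}^d\to\mathbb{R}$, and $h:\mathbb{R}^d\to\mathbb{R}$. A family of probability distributions $\{p_\theta:\theta\in\Theta\}$ with support $\mathbb{S}\subseteq\mathbb{R}^d$ is an $\mathscr{E}^{(\alpha)}$-family ($\alpha\ne1$) characterized by $h,w,f,\Theta,\mathbb{S}$ if $p_\theta(\mathbf{x})=Z(\theta)[h(\mathbf{x})+w(\theta)^\top f(\mathbf{x})]^{1/(1-\alpha)}$ for $\mathbf{x}\in\mathbb{S}$ and $0$ otherwise, for some differentiable normalizing factor $Z:\Theta\to\mathbb{R}$. It is an $\mathbb{M}^{(\gamma)}$-family ($\gamma\neq1$) characterized by $h,w,f,\Theta,\mathbb{S}$ if $p_\theta(\mathbf{x})=Z(\theta)[h(\mathbf{x})+w(\theta)^\top f(\mathbf{x})]^{1/(\gamma-1)}$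 for $\mathbf{x}\in\mathbb{S}$ and $0$ otherwise, for some differentiable normalizing factor $Z:\Theta\to\mathbb{R}$. On $\mathbb{S}$ the bracket is positive. Integrals are over $\mathbb{S}$, with respect to Lebesgue measure (continuous case) or counting measure (discrete case). Standing assumption: all integrals involved are well defined (finite), so that both families and the escort measures exist. *)

theory Defs
  imports "HOL-Analysis.Analysis"
begin

text \<open>A probability density with respect to M whose support is S, where the support is the set
  on which the density is positive (no closure is taken).\<close>

definition prob_density_on :: "'a measure \<Rightarrow> 'a set \<Rightarrow> ('a \<Rightarrow> real) \<Rightarrow> bool" where
  "prob_density_on M S p \<longleftrightarrow>
     (\<forall>x\<in>S. 0 < p x) \<and> (\<forall>x. x \<notin> S \<longrightarrow> p x = 0) \<and>
     set_integrable M S p \<and> (LINT x:S|M. p x) = 1"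

definition E_family ::
  "(real ^ 'd) measure \<Rightarrow> real \<Rightarrow> (real ^ 'd \<Rightarrow> real) \<Rightarrow> (real ^ 'k \<Rightarrow> real ^ 's) \<Rightarrow>
   (real ^ 'd \<Rightarrow> real ^ 's) \<Rightarrow> (real ^ 'k) set \<Rightarrow> (real ^ 'd) set \<Rightarrow>
   (real ^ 'k \<Rightarrow> real ^ 'd \<Rightarrow> real) \<Rightarrow> bool" where
  "E_family M \<alpha> h w f \<Theta> S p \<longleftrightarrow>
     \<alpha> \<noteq> 1 \<and> (\<forall>\<theta>\<in>\<Theta>. prob_density_on M S (p \<theta>)) \<and>
     (\<exists>Z. Z differentiable_on \<Theta> \<and>
        (\<forall>\<theta>\<in>\<Theta>. \<forall>x. p \<theta> x =
           (if x \<in> S then Z \<theta> * (h x + w \<theta> \<bullet> f x) powr (1 / (1 - \<alpha>)) else 0)))"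

definition M_family ::
  "(real ^ 'd) measure \<Rightarrow> real \<Rightarrow> (real ^ 'd \<Rightarrow> real) \<Rightarrow> (real ^ 'k \<Rightarrow> real ^ 's) \<Rightarrow>
   (real ^ 'd \<Rightarrow> real ^ 's) \<Rightarrow> (real ^ 'k) set \<Rightarrow> (real ^ 'd) set \<Rightarrow>
   (real ^ 'k \<Rightarrow> real ^ 'd \<Rightarrow> real) \<Rightarrow> bool" where
  "M_family M \<gamma> h w f \<Theta> S p \<longleftrightarrow>
     \<gamma> \<noteq> 1 \<and> (\<forall>\<theta>\<in>\<Theta>. prob_density_on M S (p \<theta>)) \<and>
     (\<exists>Z. Z differentiable_on \<Theta> \<and>
        (\<forall>\<theta>\<in>\<Theta>. \<forall>x. p \<theta> x =
           (if x \<in> S then Z \<theta> * (h x + w \<theta> \<bullet> f x) powr (1 / (\<gamma> - 1)) else 0)))"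

text \<open>The escort density is set to 0 off the support S explicitly, because for negative \<alpha> the
  power of the value 0 has no meaning there.\<close>

definition escort :: "'a measure \<Rightarrow> 'a set \<Rightarrow> real \<Rightarrow> ('a \<Rightarrow> real) \<Rightarrow> 'a \<Rightarrow> real" where
  "escort M S \<alpha> p =
     (\<lambda>x. if x \<in> S then p x powr \<alpha> / (LINT y:S|M. p y powr \<alpha>) else 0)"

end

theory Submission
  imports Defs
begin

text \<open>Since 1 / (1 / \<alpha> - 1) = \<alpha> / (1 - \<alpha>), the \<alpha>-th power of a member of the first family is on S
  a constant multiple of the member of the second family with the same parameter, and both have
  integral 1 after normalization; so the escort map sends p \<theta> to q \<theta>. Conversely, an escort density
  determines p up to a constant factor, and hence determines the probability density p.\<close>

text \<open>Since \<open>q\<close> has integral 1, integrating a function proportional to it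
  recovers the proportionality constant.\<close>

lemma prob_density_on_integral_cmult:
  assumes "prob_density_on M S q" and "\<And>x. x \<in> S \<Longrightarrow> g x = c * q x"
  shows "(LINT x:S|M. g x) = c"
proof -
  have "(LINT x:S|M. g x) = (LINT x:S|M. c * q x)"
    unfolding set_lebesgue_integral_def
    by (rule Bochner_Integration.integral_cong) (auto simp: assms(2) indicator_def)
  also have "\<dots> = c"
    using assms(1) by (simp add: prob_density_on_def)
  finally show ?thesis .
qed

text \<open>An integral over the empty set is 0, not 1. The point obtained this way is where the
  signs of normalizing constants are read off.\<close>

lemma prob_density_on_nonempty:
  assumes "prob_density_on M S p"
  shows "S \<noteq> {}"
  using assms by (auto simp: prob_density_on_def set_lebesgue_integral_def)

lemma prob_density_on_proportional_eq:
  assumes p: "prob_density_on M S p" and q: "prob_density_on M S q"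
    and eq: "\<And>x. x \<in> S \<Longrightarrow> p x = c * q x"
  shows "p = q"
proof -
  have "c = 1"
    using prob_density_on_integral_cmult[OF q eq] p by (simp add: prob_density_on_def)
  then show ?thesis
    using p q eq by (intro ext) (metis mult_1 prob_density_on_def)
qed

text \<open>The denominator of the escort equals \<open>c\<close>, so the division cancels
  \<open>c\<close> and leaves \<open>q\<close>; this requires \<open>c\<close> to be
  nonzero.\<close>

lemma escort_eqI:
  assumes q: "prob_density_on M S q" and "c \<noteq> 0"
    and eq: "\<And>x. x \<in> S \<Longrightarrow> p x powr \<alpha> = c * q x"
  shows "escort M S \<alpha> p = q"
  using prob_density_on_integral_cmult[OF q eq] assms
  by (auto simp: escort_def prob_density_on_def fun_eq_iff)

text \<open>Requiring the escort to be a density excludes the case of a divergent integral, where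
  the escort is the zero function.\<close>

lemma inj_on_escort:
  assumes "\<alpha> \<noteq> 0"
  shows "inj_on (escort M S \<alpha>)
           {p. prob_density_on M S p \<and> prob_density_on M S (escort M S \<alpha> p)}"
proof (intro inj_onI, clarify)
  fix p p'
  assume p: "prob_density_on M S p" and p': "prob_density_on M S p'"
    and e: "prob_density_on M S (escort M S \<alpha> p)" and eq: "escort M S \<alpha> p = escort M S \<alpha> p'"
  define I where "I r = (LINT y:S|M. r y powr \<alpha>)" for r :: "'a \<Rightarrow> real"
  \<comment> \<open>At a point of \<open>S\<close> both the escort and its numerator are positive,
    hence so is the denominator. A zero denominator would make the quotient 0.\<close>
  have I_pos: "0 < I r"
    if r: "prob_density_on M S r" and er: "prob_density_on M S (escort M S \<alpha> r)" for r
  proof -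
    obtain x where "x \<in> S" using prob_density_on_nonempty[OF r] by blast
    then have "0 < r x powr \<alpha> / I r" "0 < r x powr \<alpha>"
      using r er by (force simp: prob_density_on_def escort_def I_def)+
    then show ?thesis by (simp add: zero_less_divide_iff)
  qed
  \<comment> \<open>Inverse of the escort map up to a constant: multiply by the normalizer and take
    the power 1 / \<alpha>.\<close>
  have rec: "r x = I r powr (1 / \<alpha>) * escort M S \<alpha> r x powr (1 / \<alpha>)"
    if r: "prob_density_on M S r" and er: "prob_density_on M S (escort M S \<alpha> r)" and x: "x \<in> S"
    for r x
  proof -
    have "0 < r x" "r x powr \<alpha> = I r * escort M S \<alpha> r x"
      using r x I_pos[OF r er] by (auto simp: prob_density_on_def escort_def I_def)
    moreover have "r x = (r x powr \<alpha>) powr (1 / \<alpha>)"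
      using \<open>0 < r x\<close> assms by (simp add: powr_powr)
    ultimately show ?thesis
      using er x I_pos[OF r er] by (simp add: powr_mult)
  qed
  have e': "prob_density_on M S (escort M S \<alpha> p')" using e eq by simp
  show "p = p'"
  proof (rule prob_density_on_proportional_eq[OF p p'])
    fix x assume x: "x \<in> S"
    \<comment> \<open>The two densities share one escort, so only the constants from
      \<open>rec\<close> differ, and their ratio is the factor.\<close>
    show "p x = I p powr (1 / \<alpha>) / I p' powr (1 / \<alpha>) * p' x"
      unfolding rec[OF p e x] rec[OF p' e' x] eq using I_pos[OF p' e'] by simp
  qed
qed

lemma escort_E_family:
  assumes E: "E_family M \<alpha> h w f \<Theta> S p" and Mf: "M_family M (1 / \<alpha>) h w f \<Theta> S q"
    and "\<alpha> \<noteq> 0" and \<theta>: "\<theta> \<in> \<Theta>"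
  shows "escort M S \<alpha> (p \<theta>) = q \<theta>"
proof -
  define b where "b x = h x + w \<theta> \<bullet> f x" for x
  obtain Z where Z: "\<And>x. x \<in> S \<Longrightarrow> p \<theta> x = Z * b x powr (1 / (1 - \<alpha>))"
    using E \<theta> unfolding E_family_def b_def by metis
  obtain Z' where Z': "\<And>x. x \<in> S \<Longrightarrow> q \<theta> x = Z' * b x powr (1 / (1 / \<alpha> - 1))"
    using Mf \<theta> unfolding M_family_def b_def by metis
  have p: "prob_density_on M S (p \<theta>)" and q: "prob_density_on M S (q \<theta>)"
    using E Mf \<theta> by (auto simp: E_family_def M_family_def)
  obtain x0 where x0: "x0 \<in> S" using prob_density_on_nonempty[OF p] by blast
  then have "0 < p \<theta> x0" "0 < q \<theta> x0" using p q by (auto simp: prob_density_on_def)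
  \<comment> \<open>A value of \<open>powr\<close> is never negative, so a positive product forces a
    positive factor.\<close>
  then have "0 < Z" "0 < Z'"
    using Z[OF x0] Z'[OF x0] by (auto simp: zero_less_mult_iff)
  have expo: "1 / (1 - \<alpha>) * \<alpha> = 1 / (1 / \<alpha> - 1)"
    using \<open>\<alpha> \<noteq> 0\<close> E by (simp add: E_family_def field_simps)
  show ?thesis
  proof (rule escort_eqI[OF q])
    \<comment> \<open>The numerator comes from raising \<open>p \<theta>\<close> to the power
      \<alpha>, the denominator from solving the formula for \<open>q \<theta>\<close> for the power
      of \<open>b x\<close>.\<close>
    show "Z powr \<alpha> / Z' \<noteq> 0" using \<open>0 < Z\<close> \<open>0 < Z'\<close> by simp
    fix x assume x: "x \<in> S"
    have "p \<theta> x powr \<alpha> = Z powr \<alpha> * b x powr (1 / (1 - \<alpha>) * \<alpha>)"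
      using \<open>0 < Z\<close> by (simp add: Z[OF x] powr_mult powr_powr)
    then show "p \<theta> x powr \<alpha> = Z powr \<alpha> / Z' * q \<theta> x"
      using \<open>0 < Z'\<close> unfolding expo by (simp add: Z'[OF x])
  qed
qed

theorem lemma7:
  fixes M :: "(real ^ 'd) measure"
    and \<alpha> :: real
    and h :: "real ^ 'd \<Rightarrow> real"
    and w :: "real ^ 'k \<Rightarrow> real ^ 's"
    and f :: "real ^ 'd \<Rightarrow> real ^ 's"
    and \<Theta> :: "(real ^ 'k) set"
    and S :: "(real ^ 'd) set"
    and p q :: "real ^ 'k \<Rightarrow> real ^ 'd \<Rightarrow> real"
  assumes "M = lebesgue \<or> M = count_space UNIV"
    and "\<alpha> \<noteq> 0" and "\<alpha> \<noteq> 1"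
    and "open \<Theta>"
    and "\<forall>i. (\<lambda>\<theta>. w \<theta> $ i) differentiable_on \<Theta>"
    and "\<forall>\<theta>\<in>\<Theta>. \<forall>x\<in>S. 0 < h x + w \<theta> \<bullet> f x"
    and "E_family M \<alpha> h w f \<Theta> S p"
    and "M_family M (1 / \<alpha>) h w f \<Theta> S q"
  shows "bij_betw (escort M S \<alpha>) (p ` \<Theta>) (q ` \<Theta>)"
proof -
  have esc: "escort M S \<alpha> (p \<theta>) = q \<theta>" if "\<theta> \<in> \<Theta>" for \<theta>
    using assms that by (intro escort_E_family) auto
  \<comment> \<open>Each escort is a density because it equals \<open>q \<theta>\<close>, a member
    of the second family.\<close>
  have "p ` \<Theta> \<subseteq> {r. prob_density_on M S r \<and> prob_density_on M S (escort M S \<alpha> r)}"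
    using assms(7,8) by (auto simp: esc E_family_def M_family_def)
  then have "inj_on (escort M S \<alpha>) (p ` \<Theta>)"
    by (rule inj_on_subset[OF inj_on_escort[OF assms(2)]])
  moreover have "escort M S \<alpha> ` p ` \<Theta> = q ` \<Theta>"
    by (simp add: image_image esc)
  ultimately show ?thesis
    by (simp add: bij_betw_def)
qed

end
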